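(* Take $p\in [1,\infty)$ and $0<\alpha\le1$. Let $\Omega\subset \mathbb{R}^N$ be a bounded domain satisfying the $(b_0,R)$-local John condition. If $v\in\Sigma_\alpha(\Omega)$, then \[ \max_{\Gamma} v - \min_{\Gamma} v \le K\, [v]_{\alpha,\Omega}^{ \frac{N}{N+ \alpha \, p} } \, \Vert v-v_{\Omega}\Vert_{p, \Omega}^\frac{\alpha p}{N+ \alpha p} \] for some optimal constant $K$. Moreover, \[ K \le \max\left[2 \left( 1 +\frac{ \alpha p}{N} \right) , \left(\frac{d_\Omega b_0}{R}\right)^\alpha \right] \left( \frac{N}{\alpha p}\right)^{\frac{\alpha p}{N+ \alpha p}} \,\left( \frac{C b_0 }{c } \right)^\frac{\alpha N}{N+\alpha p}. \]
   Context: Let $N\ge 2$. Let $A(x)$ be a symmetric $N\times N$ matrix with measurable entries satisfying $\lambda|\xi|^2\le\langle A(x)\xi,\xi\rangle\le\Lambda|\xi|^2$ for all $x$ and $\xi\in\mathbb{R}^N$, with $\lambda,\Lambda>0$, and let $Lv=\mathrm{div}[A(x)\nabla v]$. $\Gamma$ is the boundary of $\Omega$ and $d_\Omega$ its diameter. $\Vert v\Vert_{p,\Omega}$ is the $L^p$-norm of $v$ with respect to the normalized measure $dx/|\Omega|$; $v_\Omega$ is the mean value of $v$ on $\Omega$; $[v]_{\alpha,\Omega}=\sup\{(d_\Omega/2)^\alpha|v(x_1)-v(x_2)|/|x_1-x_2|^\alpha : x_1,x_2\in\overline\Omega,\ x_1\ne x_2\}$; $\Sigma_\alpha(\Omega)$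 is the set of weak solutions $v\in C^{0,\alpha}(\overline\Omega)$ of $Lv=0$ in $\Omega$. $\Omega$ satisfies the $(b_0,R)$-local John condition ($b_0>1$, $R>0$) if for every $x\in\Gamma$ and $r\in(0,R]$ there is $x_r\in B_r(x)\cap\Omega$ with $B_{r/b_0}(x_r)\subset\Omega$, and for each $z\in B_r(x)\cap\Gamma$ there is a rectifiable path $\gamma_z:[0,1]\to\overline\Omega$ of length $\le b_0 r$ with $\gamma_z(0)=z$, $\gamma_z(1)=x_r$, and $\mathrm{dist}(\gamma_z(t),\Gamma)>|\gamma_z(t)-z|/b_0$ for all $t>0$. The constants $c\le C$, depending only on $N,\lambda,\Lambda$, are those of the mean value property for $L$ (Caffarelli; Blank–Hao): for $x_0\in\Omega$ and $0<r<r_0$ with $r_0\ge\mathrm{dist}(x_0,\Gamma)/C$ there are increasing domains $D_r(x_0)$ with $B_{cr}(x_0)\subset D_r(x_0)\subset B_{Cr}(x_0)$ such that every $v$ with $Lv\ge0$ satisfies $v(x_0)\le |D_r(x_0)|^{-1}\int_{D_r(x_0)}v\le |D_\rho(x_0)|^{-1}\int_{D_\rho(x_0)}v$ for $0<r<\rho<r_0$. *)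

theory Defs
  imports "HOL-Analysis.Analysis"
begin

definition grad :: "(real^'n \<Rightarrow> real) \<Rightarrow> real^'n \<Rightarrow> real^'n" where
  "grad f x = (\<chi> i. frechet_derivative f (at x) (axis i 1))"

coinductive smooth_fun :: "(real^'n \<Rightarrow> real) \<Rightarrow> bool" where
  "(\<forall>x. f differentiable (at x)) \<Longrightarrow>
   (\<forall>i. smooth_fun (\<lambda>x. frechet_derivative f (at x) (axis i 1))) \<Longrightarrow> smooth_fun f"

definition tsupport :: "(real^'n \<Rightarrow> real) \<Rightarrow> (real^'n) set" where
  "tsupport f = closure {x. f x \<noteq> 0}"

definition test_fun :: "(real^'n) set \<Rightarrow> (real^'n \<Rightarrow> real) \<Rightarrow> bool" where
  "test_fun \<Omega> \<phi> \<longleftrightarrow> smooth_fun \<phi> \<and> compact (tsupport \<phi>) \<and> tsupport \<phi> \<subseteq> \<Omega>"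

definition W12_loc_grad :: "(real^'n) set \<Rightarrow> (real^'n \<Rightarrow> real) \<Rightarrow> (real^'n \<Rightarrow> real^'n) \<Rightarrow> bool" where
  "W12_loc_grad \<Omega> v g \<longleftrightarrow>
     set_borel_measurable lebesgue \<Omega> v \<and> set_borel_measurable lebesgue \<Omega> g \<and>
     (\<forall>K. compact K \<and> K \<subseteq> \<Omega> \<longrightarrow>
        set_integrable lebesgue K (\<lambda>x. (v x)\<^sup>2) \<and> set_integrable lebesgue K (\<lambda>x. (norm (g x))\<^sup>2)) \<and>
     (\<forall>\<phi> i. test_fun \<Omega> \<phi> \<longrightarrow>
        (LINT x:\<Omega>|lebesgue. v x * grad \<phi> x $ i) = - (LINT x:\<Omega>|lebesgue. g x $ i * \<phi> x))"

text \<open>Weak solutions / subsolutions of  L v = div (A grad v) = 0  (resp. >= 0) in Omega.\<close>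
definition weak_solution :: "(real^'n \<Rightarrow> real^'n^'n) \<Rightarrow> (real^'n) set \<Rightarrow> (real^'n \<Rightarrow> real) \<Rightarrow> bool" where
  "weak_solution A \<Omega> v \<longleftrightarrow> (\<exists>g. W12_loc_grad \<Omega> v g \<and>
     (\<forall>\<phi>. test_fun \<Omega> \<phi> \<longrightarrow> (LINT x:\<Omega>|lebesgue. (A x *v g x) \<bullet> grad \<phi> x) = 0))"

definition weak_subsolution :: "(real^'n \<Rightarrow> real^'n^'n) \<Rightarrow> (real^'n) set \<Rightarrow> (real^'n \<Rightarrow> real) \<Rightarrow> bool" where
  "weak_subsolution A \<Omega> v \<longleftrightarrow> (\<exists>g. W12_loc_grad \<Omega> v g \<and>
     (\<forall>\<phi>. test_fun \<Omega> \<phi> \<and> (\<forall>x. 0 \<le> \<phi> x) \<longrightarrow> (LINT x:\<Omega>|lebesgue. (A x *v g x) \<bullet> grad \<phi> x) \<le> 0))"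

definition holder_on :: "real \<Rightarrow> (real^'n) set \<Rightarrow> (real^'n \<Rightarrow> real) \<Rightarrow> bool" where
  "holder_on \<alpha> S v \<longleftrightarrow> (\<exists>M. \<forall>x\<in>S. \<forall>y\<in>S. \<bar>v x - v y\<bar> \<le> M * dist x y powr \<alpha>)"

definition holder_semi :: "real \<Rightarrow> (real^'n) set \<Rightarrow> (real^'n \<Rightarrow> real) \<Rightarrow> real" where
  "holder_semi \<alpha> \<Omega> v = Sup {(diameter \<Omega> / 2) powr \<alpha> * \<bar>v x1 - v x2\<bar> / dist x1 x2 powr \<alpha> | x1 x2.
       x1 \<in> closure \<Omega> \<and> x2 \<in> closure \<Omega> \<and> x1 \<noteq> x2}"

definition Sigma_sol :: "(real^'n \<Rightarrow> real^'n^'n) \<Rightarrow> real \<Rightarrow> (real^'n) set \<Rightarrow> (real^'n \<Rightarrow> real) set" where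
  "Sigma_sol A \<alpha> \<Omega> = {v. holder_on \<alpha> (closure \<Omega>) v \<and> weak_solution A \<Omega> v}"

definition mean_on :: "(real^'n) set \<Rightarrow> (real^'n \<Rightarrow> real) \<Rightarrow> real" where
  "mean_on \<Omega> v = (LINT x:\<Omega>|lebesgue. v x) / measure lebesgue \<Omega>"

definition lp_norm_normalized :: "real \<Rightarrow> (real^'n) set \<Rightarrow> (real^'n \<Rightarrow> real) \<Rightarrow> real" where
  "lp_norm_normalized p \<Omega> v = ((LINT x:\<Omega>|lebesgue. \<bar>v x\<bar> powr p) / measure lebesgue \<Omega>) powr (1 / p)"

definition polygonal_lengths :: "(real \<Rightarrow> real^'n) \<Rightarrow> real set" where
  "polygonal_lengths \<gamma> = {(\<Sum>i<k. dist (\<gamma> (t (Suc i))) (\<gamma> (t i))) | t k.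
       t 0 = 0 \<and> t k = 1 \<and> (\<forall>i<k. t i \<le> t (Suc i))}"

definition rectifiable_path :: "(real \<Rightarrow> real^'n) \<Rightarrow> bool" where
  "rectifiable_path \<gamma> \<longleftrightarrow> path \<gamma> \<and> bdd_above (polygonal_lengths \<gamma>)"

definition path_len :: "(real \<Rightarrow> real^'n) \<Rightarrow> real" where
  "path_len \<gamma> = Sup (polygonal_lengths \<gamma>)"

definition local_John :: "real \<Rightarrow> real \<Rightarrow> (real^'n) set \<Rightarrow> bool" where
  "local_John b0 R \<Omega> \<longleftrightarrow> b0 > 1 \<and> R > 0 \<and>
     (\<forall>x\<in>frontier \<Omega>. \<forall>r. 0 < r \<and> r \<le> R \<longrightarrow>
       (\<exists>xr\<in>ball x r \<inter> \<Omega>. ball xr (r / b0) \<subseteq> \<Omega> \<and>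
          (\<forall>z\<in>ball x r \<inter> frontier \<Omega>. \<exists>\<gamma>. rectifiable_path \<gamma> \<and> path_len \<gamma> \<le> b0 * r \<and>
              path_image \<gamma> \<subseteq> closure \<Omega> \<and> \<gamma> 0 = z \<and> \<gamma> 1 = xr \<and>
              (\<forall>t\<in>{0<..1}. infdist (\<gamma> t) (frontier \<Omega>) > dist (\<gamma> t) z / b0))))"

definition avg_on :: "(real^'n) set \<Rightarrow> (real^'n \<Rightarrow> real) \<Rightarrow> real" where
  "avg_on D v = (LINT x:D|lebesgue. v x) / measure lebesgue D"

definition mean_value_property ::
    "(real^'n \<Rightarrow> real^'n^'n) \<Rightarrow> (real^'n) set \<Rightarrow> real \<Rightarrow> real \<Rightarrow> bool" where
  "mean_value_property A \<Omega> c C \<longleftrightarrow> 0 < c \<and> c \<le> C \<and>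
     (\<exists>D. \<forall>x0\<in>\<Omega>.
        (\<forall>r. 0 < r \<and> r < infdist x0 (frontier \<Omega>) / C \<longrightarrow>
            D x0 r \<in> sets lebesgue \<and> ball x0 (c * r) \<subseteq> D x0 r \<and> D x0 r \<subseteq> ball x0 (C * r)) \<and>
        (\<forall>r \<rho>. 0 < r \<and> r < \<rho> \<and> \<rho> < infdist x0 (frontier \<Omega>) / C \<longrightarrow>
            D x0 r \<subseteq> D x0 \<rho> \<and>
            (\<forall>v. continuous_on \<Omega> v \<and> weak_subsolution A \<Omega> v \<longrightarrow>
                v x0 \<le> avg_on (D x0 r) v \<and> avg_on (D x0 r) v \<le> avg_on (D x0 \<rho>) v)))"

end

theory Submission
  imports Defs
begin

text \<open>
  At a boundary maximum point \<open>x\<close> the local John condition provides \<open>x\<^sub>r\<close> within distance \<open>r\<close> of \<open>x\<close>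
  and at distance at least \<open>r / b0\<close> from the boundary. Hoelder continuity bounds \<open>v x - v x\<^sub>r\<close>, and the mean
  value property together with Jensen's inequality bounds \<open>v x\<^sub>r - m\<close> by the normalized \<open>L\<^sup>p\<close> norm of
  \<open>v - m\<close> times \<open>(|\<Omega>| / |D|)\<close> to the power \<open>1/p\<close>. The minimum is treated by passing to \<open>- v\<close>, and the
  resulting bound is optimised in \<open>r\<close>.

  The stated constant requires \<open>|\<Omega>|\<close> to be at most the volume of a ball with the same diameter. This
  isodiametric inequality follows from \<open>|A + B| \<ge> 2\<^sup>N |A|\<close> for \<open>|A| = |B|\<close>, applied to inner
  approximations \<open>A\<close> of \<open>\<Omega>\<close> by finitely many boxes and \<open>B = - A\<close>. The sum inequality is proved by the
  Hadwiger-Ohmann argument: cut \<open>A\<close> by a hyperplane separating two of its boxes and \<open>B\<close> by a parallel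
  hyperplane in the same volume ratio; the sums of corresponding halves are disjoint.
\<close>

section \<open>The isodiametric inequality\<close>

definition disjoint_box_union :: "nat \<Rightarrow> 'a::euclidean_space set \<Rightarrow> bool" where
  "disjoint_box_union n A \<longleftrightarrow> (\<exists>F. finite F \<and> card F \<le> n \<and> pairwise disjnt F \<and>
     (\<forall>B\<in>F. B \<noteq> {} \<and> (\<exists>a b. B = box a b)) \<and> A = \<Union>F)"

lemma disjoint_box_unionI:
  assumes "finite F" "card F \<le> n" "pairwise disjnt F" "\<And>B. B \<in> F \<Longrightarrow> B \<noteq> {} \<and> (\<exists>a b. B = box a b)"
  shows "disjoint_box_union n (\<Union>F)"
  unfolding disjoint_box_union_def by (intro exI[of _ F] conjI ballI assms refl) (use assms(4) in auto)

lemma disjoint_box_unionE: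
  assumes "disjoint_box_union n A"
  obtains F where "finite F" "card F \<le> n" "pairwise disjnt F"
    "\<And>B. B \<in> F \<Longrightarrow> B \<noteq> {}" "\<And>B. B \<in> F \<Longrightarrow> \<exists>a b. B = box a b" "A = \<Union>F"
  using assms unfolding disjoint_box_union_def by auto

lemma disjoint_box_union_mono: "disjoint_box_union m A \<Longrightarrow> m \<le> n \<Longrightarrow> disjoint_box_union n A"
  unfolding disjoint_box_union_def using order_trans by blast

lemma disjoint_box_union_open: "disjoint_box_union n A \<Longrightarrow> open A"
  unfolding disjoint_box_union_def by (auto intro!: open_Union)

lemma disjoint_box_union_bounded: "disjoint_box_union n A \<Longrightarrow> bounded A"
  unfolding disjoint_box_union_def by (auto intro!: bounded_Union)

lemma open_bounded_lmeasurable: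
  fixes S :: "'a::euclidean_space set"
  shows "open S \<Longrightarrow> bounded S \<Longrightarrow> S \<in> lmeasurable"
  by (simp add: lmeasurable_open)

lemma disjoint_box_union_le_1_imp_box:
  assumes "disjoint_box_union n A" "n \<le> 1"
  shows "\<exists>a b. A = box a b"
proof -
  obtain F where F: "finite F" "card F \<le> 1" "\<And>B. B \<in> F \<Longrightarrow> \<exists>a b. B = box a b" "A = \<Union>F"
    using disjoint_box_unionE[OF disjoint_box_union_mono[OF assms]] by metis
  show ?thesis
  proof (cases "F = {}")
    case True
    then have "A = box 0 (0::'a)" using F by simp
    then show ?thesis by blast
  next
    case False
    then have "card F = 1" using F by (simp add: card_gt_0_iff le_antisym Suc_leI)
    then obtain B where "F = {B}" by (auto simp: card_1_singleton_iff)
    then show ?thesis using F by auto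
  qed
qed

lemma box_Int_halfspace:
  fixes a b k :: "'a::euclidean_space"
  assumes "k \<in> Basis"
  shows "\<exists>a' b'. box a b \<inter> {x. x \<bullet> k < c} = box a' b'"
    and "\<exists>a' b'. box a b \<inter> {x. c < x \<bullet> k} = box a' b'"
proof -
  have "box a b \<inter> {x. x \<bullet> k < c} = box a (\<Sum>i\<in>Basis. (if i = k then min (b \<bullet> k) c else b \<bullet> i) *\<^sub>R i)"
    using assms by (auto simp: mem_box split: if_splits)
  moreover have "box a b \<inter> {x. c < x \<bullet> k} = box (\<Sum>i\<in>Basis. (if i = k then max (a \<bullet> k) c else a \<bullet> i) *\<^sub>R i) b"
    using assms by (auto simp: mem_box split: if_splits)
  ultimately show "\<exists>a' b'. box a b \<inter> {x. x \<bullet> k < c} = box a' b'"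
    and "\<exists>a' b'. box a b \<inter> {x. c < x \<bullet> k} = box a' b'" by blast+
qed

text \<open>\<open>G\<close> contains every box that meets \<open>H\<close>. Discarding the others
  keeps the pieces non-empty and bounds their number by that of \<open>G\<close>, which is how a cut
  lowers the count.\<close>

lemma disjoint_box_union_Int:
  assumes F: "finite F" "pairwise disjnt F"
    and H: "\<And>B. B \<in> F \<Longrightarrow> \<exists>a b. B \<inter> H = box a b"
    and G: "G \<subseteq> F" "card G \<le> n" "\<And>B. B \<in> F - G \<Longrightarrow> B \<inter> H = {}"
  shows "disjoint_box_union n (\<Union>F \<inter> H)"
proof -
  let ?F = "(\<lambda>B. B \<inter> H) ` G - {{}}"
  have fG: "finite G" using F G finite_subset by blast
  have "card ?F \<le> card ((\<lambda>B. B \<inter> H) ` G)" using fG by (intro card_mono) auto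
  also have "\<dots> \<le> n" using card_image_le[OF fG] G(2) order_trans by blast
  finally have "card ?F \<le> n" .
  moreover have "pairwise disjnt ?F"
    using F(2) G(1) unfolding pairwise_def disjnt_def by blast
  moreover have "\<Union>F \<inter> H = \<Union>?F" using G by blast
  moreover have "B \<noteq> {} \<and> (\<exists>a b. B = box a b)" if "B \<in> ?F" for B using that H G(1) by auto
  ultimately show ?thesis using disjoint_box_unionI[of ?F n] fG by simp
qed

lemma disjoint_box_union_halfspace:
  fixes A :: "'a::euclidean_space set"
  assumes "disjoint_box_union n A" "k \<in> Basis"
  shows "disjoint_box_union n (A \<inter> {x. x \<bullet> k < c})" "disjoint_box_union n (A \<inter> {x. c < x \<bullet> k})"
proof -
  obtain F where F: "finite F" "card F \<le> n" "pairwise disjnt F"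
    "\<And>B. B \<in> F \<Longrightarrow> B \<noteq> {}" "\<And>B. B \<in> F \<Longrightarrow> \<exists>a b. B = box a b" "A = \<Union>F"
    using disjoint_box_unionE[OF assms(1)] by metis
  show "disjoint_box_union n (A \<inter> {x. x \<bullet> k < c})" "disjoint_box_union n (A \<inter> {x. c < x \<bullet> k})"
    unfolding F(6)
    by (rule disjoint_box_union_Int[OF F(1,3) _ subset_refl F(2)];
        use F(5) box_Int_halfspace[OF assms(2)] in fastforce)+
qed

text \<open>Two disjoint non-empty boxes have disjoint projections on some axis. A hyperplane
  between these projections leaves a whole box on each side, so each half loses at least one
  box.\<close>

lemma disjoint_box_union_split:
  fixes A :: "'a::euclidean_space set"
  assumes "disjoint_box_union (Suc n) A" "n \<ge> 1"
  shows "\<exists>k\<in>Basis. \<exists>c. disjoint_box_union n (A \<inter> {x. x \<bullet> k < c}) \<and> disjoint_box_union n (A \<inter> {x. c < x \<bullet> k})"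
proof -
  obtain F where F: "finite F" "card F \<le> Suc n" "pairwise disjnt F"
    "\<And>B. B \<in> F \<Longrightarrow> B \<noteq> {}" "\<And>B. B \<in> F \<Longrightarrow> \<exists>a b. B = box a b" "A = \<Union>F"
    using disjoint_box_unionE[OF assms(1)] by metis
  show ?thesis
  proof (cases "card F \<le> 1")
    case True
    then have "disjoint_box_union n A"
      using disjoint_box_unionI[of F n] F assms(2) by simp
    then show ?thesis using disjoint_box_union_halfspace SOME_Basis by blast
  next
    case False
    then obtain B1 B2 where B: "B1 \<in> F" "B2 \<in> F" "B1 \<noteq> B2"
      by (metis card_le_Suc0_iff_eq[OF F(1)] One_nat_def)
    then obtain a1 b1 a2 b2 where ab: "B1 = box a1 b1" "B2 = box a2 b2" using F(5) by meson
    have ne: "box a1 b1 \<noteq> {}" "box a2 b2 \<noteq> {}" using F(4) B ab by auto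
    have "box a1 b1 \<inter> box a2 b2 = {}" using F(3) B ab unfolding pairwise_def disjnt_def by blast
    then obtain k where k: "k \<in> Basis" "b1 \<bullet> k \<le> a2 \<bullet> k \<or> b2 \<bullet> k \<le> a1 \<bullet> k"
      using ne unfolding disjoint_interval box_ne_empty by (meson not_less)
    \<comment> \<open>The cut goes through the upper face of the lower box. As the boxes are open,
      both lie strictly on their sides even if the other box starts at this same coordinate.\<close>
    obtain c B B' where c: "B \<in> F" "B' \<in> F" "B \<subseteq> {x. x \<bullet> k < c}" "B' \<subseteq> {x. c < x \<bullet> k}"
    proof (cases "b1 \<bullet> k \<le> a2 \<bullet> k")
      case True
      then have "B1 \<subseteq> {x. x \<bullet> k < b1 \<bullet> k}" "B2 \<subseteq> {x. b1 \<bullet> k < x \<bullet> k}"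
        using k(1) ab by (force simp: mem_box)+
      then show ?thesis using B that by blast
    next
      case False
      then have "B2 \<subseteq> {x. x \<bullet> k < b2 \<bullet> k}" "B1 \<subseteq> {x. b2 \<bullet> k < x \<bullet> k}"
        using k ab by (force simp: mem_box)+
      then show ?thesis using B that by blast
    qed
    have "disjoint_box_union n (\<Union>F \<inter> {x. x \<bullet> k < c})"
    proof (rule disjoint_box_union_Int[OF F(1,3)])
      show "card (F - {B'}) \<le> n" using F(1,2) c by (simp add: card_Diff_singleton)
    qed (use F(5) c box_Int_halfspace(1)[OF k(1)] in fastforce)+
    moreover have "disjoint_box_union n (\<Union>F \<inter> {x. c < x \<bullet> k})"
    proof (rule disjoint_box_union_Int[OF F(1,3)])
      show "card (F - {B}) \<le> n" using F(1,2) c by (simp add: card_Diff_singleton)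
    qed (use F(5) c box_Int_halfspace(2)[OF k(1)] in fastforce)+
    ultimately show ?thesis using k(1) F(6) by blast
  qed
qed

section \<open>Volumes cut off by hyperplanes\<close>

lemma measure_split_hyperplane:
  fixes S :: "'a::euclidean_space set"
  assumes S: "open S" "bounded S" and k: "k \<in> Basis"
  shows "measure lebesgue S = measure lebesgue (S \<inter> {x. x \<bullet> k < c}) + measure lebesgue (S \<inter> {x. c < x \<bullet> k})"
proof -
  let ?l = "S \<inter> {x. x \<bullet> k < c}" and ?g = "S \<inter> {x. c < x \<bullet> k}"
  have o: "open ?l" "open ?g"
    using S(1) open_halfspace_component_lt[of k c] open_halfspace_component_gt[of c k] by (auto intro: open_Int)
  have m: "?l \<in> lmeasurable" "?g \<in> lmeasurable"
    using o S(2) by (auto intro!: open_bounded_lmeasurable bounded_Int)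
  have "measure lebesgue (?l \<union> ?g) = measure lebesgue S"
    by (rule measure_negligible_symdiff[OF open_bounded_lmeasurable[OF S]])
      (rule negligible_subset[OF negligible_standard_hyperplane[OF k, of c]], auto)
  moreover have "measure lebesgue (?l \<union> ?g) = measure lebesgue ?l + measure lebesgue ?g"
  proof -
    have "?l \<inter> ?g = {}" by auto
    then show ?thesis using m by (simp add: measure_Un3)
  qed
  ultimately show ?thesis by simp
qed

text \<open>This is the intermediate value theorem for the volume below level \<open>c\<close>.
  Continuity holds because the part of a thin slab inside a bounding box has small volume.\<close>

lemma halfspace_measure_attained:
  fixes S :: "'a::euclidean_space set"
  assumes S: "open S" "bounded S" and k: "k \<in> Basis" and y: "0 \<le> y" "y \<le> measure lebesgue S"
  shows "\<exists>c. measure lebesgue (S \<inter> {x. x \<bullet> k < c}) = y"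
proof -
  define f where "f c = measure lebesgue (S \<inter> {x. x \<bullet> k < c})" for c
  obtain a where a: "S \<subseteq> cbox (-a) a" using bounded_subset_cbox_symmetric[OF S(2)] by blast
  have m: "S \<inter> {x. x \<bullet> k < c} \<in> lmeasurable" for c
    using S open_halfspace_component_lt[of k c] by (intro open_bounded_lmeasurable) (auto intro: open_Int bounded_Int)
  have low: "f (-a \<bullet> k) = 0"
  proof -
    have "S \<inter> {x. x \<bullet> k < -a \<bullet> k} = {}" using a k by (force simp: mem_box)
    then show ?thesis by (simp add: f_def)
  qed
  have high: "f (a \<bullet> k + 1) = measure lebesgue S"
  proof -
    have "S \<inter> {x. x \<bullet> k < a \<bullet> k + 1} = S" using a k by (force simp: mem_box)
    then show ?thesis by (simp add: f_def)
  qed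
  have cont: "isCont f c" for c
    unfolding continuous_at_eps_delta
  proof (intro allI impI)
    fix e :: real assume "e > 0"
    obtain d where d: "d > 0" "measure lborel (cbox (-a) a \<inter> {x. \<bar>x \<bullet> k - c\<bar> \<le> d}) < e"
      using content_doublesplit[OF \<open>e > 0\<close> k] by blast
    let ?T = "cbox (-a) a \<inter> {x. \<bar>x \<bullet> k - c\<bar> \<le> d}"
    have cT: "closed ?T" by (intro closed_Int closed_cbox closed_Collect_le continuous_intros)
    then have T: "?T \<in> lmeasurable" by (simp add: bounded_Int compact_eq_bounded_closed lmeasurable_compact)
    have eqT: "measure lebesgue ?T = measure lborel ?T" using cT by (simp add: measure_completion)
    \<comment> \<open>Points counted at level \<open>s\<close> but not at level \<open>t\<close> lie
      in the slab \<open>?T\<close> around \<open>c\<close>. Stating this for both \<open>s\<close>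
      and \<open>t\<close> gives the two one-sided estimates at once.\<close>
    have le: "f s \<le> f t + measure lebesgue ?T" if "\<bar>s - c\<bar> < d" "\<bar>t - c\<bar> < d" for s t
    proof -
      have "f s \<le> measure lebesgue ((S \<inter> {x. x \<bullet> k < t}) \<union> ?T)"
        unfolding f_def using m T a that by (intro measure_mono_fmeasurable) (auto intro: fmeasurable.Un)
      also have "\<dots> \<le> f t + measure lebesgue ?T"
        unfolding f_def using m T by (intro measure_Un_le) auto
      finally show ?thesis .
    qed
    have "dist (f t) (f c) < e" if "dist t c < d" for t
      using le[of t c] le[of c t] that d eqT by (auto simp: dist_real_def)
    then show "\<exists>d>0. \<forall>x'. dist x' c < d \<longrightarrow> dist (f x') (f c) < e" using d(1) by blast
  qed
  \<comment> \<open>The bounding box may itself be empty when \<open>S\<close> is, so the order of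
    the endpoints is only available for non-empty \<open>S\<close>.\<close>
  have "-a \<bullet> k \<le> a \<bullet> k + 1 \<or> S = {}"
    using a k by (force simp: mem_box)
  then show ?thesis
  proof
    assume "S = {}" then show ?thesis using y by auto
  next
    assume "-a \<bullet> k \<le> a \<bullet> k + 1"
    then show ?thesis using IVT[of f "-a \<bullet> k" y "a \<bullet> k + 1"] low high y cont f_def by auto
  qed
qed

section \<open>Volume of Minkowski sums\<close>

lemma box_sum:
  fixes a b c d :: "'a::euclidean_space"
  assumes "box a b \<noteq> {}" "box c d \<noteq> {}"
  shows "{x + y |x y. x \<in> box a b \<and> y \<in> box c d} = box (a + c) (b + d)"
proof
  show "{x + y |x y. x \<in> box a b \<and> y \<in> box c d} \<subseteq> box (a + c) (b + d)"
    by (fastforce simp: mem_box inner_add_left intro: add_strict_mono)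
  show "box (a + c) (b + d) \<subseteq> {x + y |x y. x \<in> box a b \<and> y \<in> box c d}"
  proof
    fix z assume z: "z \<in> box (a + c) (b + d)"
    \<comment> \<open>\<open>l i\<close> is the relative position of \<open>z\<close> along axis
      \<open>i\<close>. Splitting \<open>z\<close> into points with this same relative position in
      both boxes yields the two summands.\<close>
    define l where "l i = (z \<bullet> i - (a + c) \<bullet> i) / ((b + d) \<bullet> i - (a + c) \<bullet> i)" for i
    have l: "0 < l i" "l i < 1" "(z - a - c) \<bullet> i = l i * ((b - a) \<bullet> i) + l i * ((d - c) \<bullet> i)"
      "(b - a) \<bullet> i > 0" "(d - c) \<bullet> i > 0" if "i \<in> Basis" for i
    proof -
      show p: "(b - a) \<bullet> i > 0" "(d - c) \<bullet> i > 0"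
        using assms that by (auto simp: box_ne_empty inner_diff_left)
      let ?D = "(b + d) \<bullet> i - (a + c) \<bullet> i"
      have D: "?D > 0" using p by (simp add: inner_simps)
      have "(a + c) \<bullet> i < z \<bullet> i" "z \<bullet> i < (b + d) \<bullet> i" using z that by (auto simp: mem_box)
      then show "0 < l i" "l i < 1" unfolding l_def using D by (simp_all add: divide_simps)
      have "l i * ?D = z \<bullet> i - (a + c) \<bullet> i" using D unfolding l_def by simp
      then show "(z - a - c) \<bullet> i = l i * ((b - a) \<bullet> i) + l i * ((d - c) \<bullet> i)"
        by (simp add: inner_simps algebra_simps)
    qed
    define x where "x = (\<Sum>i\<in>Basis. (a \<bullet> i + l i * ((b - a) \<bullet> i)) *\<^sub>R i)"
    have xi: "x \<bullet> i = a \<bullet> i + l i * ((b - a) \<bullet> i)" if "i \<in> Basis" for i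
      using that by (simp add: x_def)
    have bd: "0 < t * u \<and> t * u < u" if "0 < t" "t < 1" "0 < u" for t u :: real
      using that by simp
    have "x \<in> box a b"
      unfolding mem_box
    proof
      fix i :: 'a assume i: "i \<in> Basis"
      show "a \<bullet> i < x \<bullet> i \<and> x \<bullet> i < b \<bullet> i"
        using bd[OF l(1)[OF i] l(2)[OF i] l(4)[OF i]] xi[OF i] by (simp add: inner_diff_left)
    qed
    moreover have "z - x \<in> box c d"
      unfolding mem_box
    proof
      fix i :: 'a assume i: "i \<in> Basis"
      have "(z - x) \<bullet> i = c \<bullet> i + l i * ((d - c) \<bullet> i)"
        using l(3)[OF i] xi[OF i] by (simp add: inner_diff_left)
      then show "c \<bullet> i < (z - x) \<bullet> i \<and> (z - x) \<bullet> i < d \<bullet> i"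
        using bd[OF l(1)[OF i] l(2)[OF i] l(5)[OF i]] by (simp add: inner_diff_left)
    qed
    ultimately show "z \<in> {x + y |x y. x \<in> box a b \<and> y \<in> box c d}"
      by (smt (verit) mem_Collect_eq add.commute diff_add_cancel)
  qed
qed

text \<open>The side lengths of the sum box are \<open>s + t\<close>, and
  \<open>(s + t)\<^sup>2\<close> is at least \<open>4 * s * t\<close>. Multiplying over the axes and
  using equality of the two volumes gives the square of the claim, so no roots are needed.\<close>

lemma measure_box_sum_ge:
  fixes a b c d :: "'a::euclidean_space"
  assumes eq: "measure lebesgue (box a b) = measure lebesgue (box c d)"
  shows "2 ^ DIM('a) * measure lebesgue (box a b) \<le> measure lebesgue {x + y |x y. x \<in> box a b \<and> y \<in> box c d}"
proof (cases "box a b = {} \<or> box c d = {}")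
  case True
  then have "measure lebesgue (box a b) = 0" using eq by auto
  then show ?thesis by simp
next
  case False
  then have ne: "box a b \<noteq> {}" "box c d \<noteq> {}" by auto
  have p: "(b - a) \<bullet> i > 0" "(d - c) \<bullet> i > 0" if "i \<in> Basis" for i
    using ne that by (auto simp: box_ne_empty inner_diff_left)
  have m: "measure lebesgue (box u w) = (\<Prod>i\<in>Basis. (w - u) \<bullet> i)"
    if "\<And>i. i \<in> Basis \<Longrightarrow> (w - u) \<bullet> i > 0" for u w :: 'a
    using that by (simp add: measure_completion inner_diff_left less_imp_le)
  let ?P = "\<Prod>i\<in>Basis. (b - a) \<bullet> i" and ?Q = "\<Prod>i\<in>Basis. (d - c) \<bullet> i"
    and ?R = "\<Prod>i\<in>Basis. ((b + d) - (a + c)) \<bullet> i"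
  have PQ: "?P = ?Q" using eq m[of b a, OF p(1)] m[of d c, OF p(2)] by simp
  have pos: "((b + d) - (a + c)) \<bullet> i > 0" if "i \<in> Basis" for i
    using p[OF that] by (simp add: inner_simps)
  have "(2 ^ DIM('a) * ?P)\<^sup>2 = (\<Prod>i\<in>Basis. 4 * ((b - a) \<bullet> i) * ((d - c) \<bullet> i))"
    using PQ by (simp add: prod.distrib power2_eq_square flip: power_mult_distrib)
  also have "\<dots> \<le> (\<Prod>i\<in>Basis. (((b + d) - (a + c)) \<bullet> i)\<^sup>2)"
  proof (rule prod_mono, safe)
    fix i :: 'a assume i: "i \<in> Basis"
    show "0 \<le> 4 * ((b - a) \<bullet> i) * ((d - c) \<bullet> i)" using p[OF i] by simp
    have "(((b + d) - (a + c)) \<bullet> i) = (b - a) \<bullet> i + (d - c) \<bullet> i" by (simp add: inner_simps)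
    moreover have "4 * s * t \<le> (s + t)\<^sup>2" for s t :: real
      using zero_le_power2[of "s - t"] by (simp add: power2_eq_square algebra_simps)
    ultimately show "4 * ((b - a) \<bullet> i) * ((d - c) \<bullet> i) \<le> (((b + d) - (a + c)) \<bullet> i)\<^sup>2" by simp
  qed
  also have "\<dots> = ?R\<^sup>2" by (simp add: prod_power_distrib)
  finally have "2 ^ DIM('a) * ?P \<le> ?R"
    by (rule power2_le_imp_le) (rule prod_nonneg, use pos in \<open>auto intro: less_imp_le\<close>)
  then show ?thesis
    using box_sum[OF ne] m[of b a, OF p(1)] m[of "b + d" "a + c", OF pos] by simp
qed

text \<open>A cut strictly lowers the box bound of one set and does not raise that of the other, so
  induction on \<open>n + m\<close> applies to both pairs of halves. Equality of volumes passes to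
  the halves by the choice of the second cut; single boxes are the base case.\<close>

lemma disjoint_box_union_measure_sum_ge:
  fixes A B :: "'a::euclidean_space set"
  assumes "disjoint_box_union n A" "disjoint_box_union m B" "measure lebesgue A = measure lebesgue B"
  shows "2 ^ DIM('a) * measure lebesgue A \<le> measure lebesgue {x + y |x y. x \<in> A \<and> y \<in> B}"
  using assms
proof (induction "n + m" arbitrary: n m A B rule: less_induct)
  case less
  note IH = less.hyps
  \<comment> \<open>The step is stated for fresh sets and bounds with the same total, so that it
    also serves with the two sets interchanged.\<close>
  have step: "2 ^ DIM('a) * measure lebesgue A \<le> measure lebesgue {x + y |x y. x \<in> A \<and> y \<in> B}"
    if asm: "disjoint_box_union n' A" "disjoint_box_union m' B" "measure lebesgue A = measure lebesgue B"
      "n' + m' = n + m" "2 \<le> n'" for A B :: "'a set" and n' m'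
  proof -
    obtain j where j: "n' = Suc j" "j \<ge> 1" using \<open>2 \<le> n'\<close> by (cases n') auto
    obtain k c where k: "k \<in> Basis" "disjoint_box_union j (A \<inter> {x. x \<bullet> k < c})"
      "disjoint_box_union j (A \<inter> {x. c < x \<bullet> k})"
      using disjoint_box_union_split[of j A] asm(1) j by blast
    have oA: "open A" "bounded A" and oB: "open B" "bounded B"
      using asm disjoint_box_union_open disjoint_box_union_bounded by blast+
    let ?A1 = "A \<inter> {x. x \<bullet> k < c}" and ?A2 = "A \<inter> {x. c < x \<bullet> k}"
    have sA: "measure lebesgue A = measure lebesgue ?A1 + measure lebesgue ?A2"
      by (rule measure_split_hyperplane[OF oA k(1)])
    obtain d where d: "measure lebesgue (B \<inter> {x. x \<bullet> k < d}) = measure lebesgue ?A1"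
      using halfspace_measure_attained[OF oB k(1), of "measure lebesgue ?A1"] sA asm(3) by auto
    let ?B1 = "B \<inter> {x. x \<bullet> k < d}" and ?B2 = "B \<inter> {x. d < x \<bullet> k}"
    have sB: "measure lebesgue B = measure lebesgue ?B1 + measure lebesgue ?B2"
      by (rule measure_split_hyperplane[OF oB k(1)])
    have bB: "disjoint_box_union m' ?B1" "disjoint_box_union m' ?B2"
      using disjoint_box_union_halfspace[OF asm(2) k(1)] by blast+
    let ?S1 = "{x + y |x y. x \<in> ?A1 \<and> y \<in> ?B1}" and ?S2 = "{x + y |x y. x \<in> ?A2 \<and> y \<in> ?B2}"
      and ?S = "{x + y |x y. x \<in> A \<and> y \<in> B}"
    have lt: "j + m' < n + m" using asm(4) j(1) by simp
    have 1: "2 ^ DIM('a) * measure lebesgue ?A1 \<le> measure lebesgue ?S1"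
      by (rule IH[OF lt k(2) bB(1) d[symmetric]])
    have e2: "measure lebesgue ?A2 = measure lebesgue ?B2" using sA sB d asm(3) by simp
    have 2: "2 ^ DIM('a) * measure lebesgue ?A2 \<le> measure lebesgue ?S2"
      by (rule IH[OF lt k(3) bB(2) e2])
    have lm: "{x + y |x y. x \<in> U \<and> y \<in> V} \<in> lmeasurable"
      if "disjoint_box_union u U" "disjoint_box_union v V" for U V :: "'a set" and u v
    proof (rule open_bounded_lmeasurable)
      have eq: "{x + y |x y. x \<in> U \<and> y \<in> V} = (\<Union>x\<in>U. \<Union>y\<in>V. {x + y})" by blast
      show "open {x + y |x y. x \<in> U \<and> y \<in> V}"
        using open_sums[of U V] disjoint_box_union_open[OF that(1)] eq by simp
      show "bounded {x + y |x y. x \<in> U \<and> y \<in> V}"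
        using bounded_sums[OF disjoint_box_union_bounded[OF that(1)] disjoint_box_union_bounded[OF that(2)]] eq
        by simp
    qed
    have S: "?S1 \<in> lmeasurable" "?S2 \<in> lmeasurable" "?S \<in> lmeasurable"
      using lm k bB asm by blast+
    \<comment> \<open>The hyperplane at level \<open>c + d\<close> separates the two partial sums,
      so their volumes add.\<close>
    have "?S1 \<inter> ?S2 = {}"
    proof -
      have "z \<bullet> k < c + d" if "z \<in> ?S1" for z using that by (auto simp: inner_add_left)
      moreover have "z \<bullet> k > c + d" if "z \<in> ?S2" for z using that by (auto simp: inner_add_left)
      ultimately show ?thesis by fastforce
    qed
    then have "measure lebesgue ?S1 + measure lebesgue ?S2 = measure lebesgue (?S1 \<union> ?S2)"
      using S by (subst measure_Un3) auto
    also have "\<dots> \<le> measure lebesgue ?S"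
      by (rule measure_mono_fmeasurable) (use S in blast)+
    finally show ?thesis using 1 2 sA by (simp add: algebra_simps)
  qed
  consider "n \<ge> 2" | "m \<ge> 2" | "n \<le> 1" "m \<le> 1" by linarith
  then show ?case
  proof cases
    case 1 then show ?thesis using step[OF less.prems] by simp
  next
    case 2
    have "{x + y |x y. x \<in> B \<and> y \<in> A} = {x + y |x y. x \<in> A \<and> y \<in> B}"
      by (metis (no_types, opaque_lifting) add.commute)
    then show ?thesis using step[OF less.prems(2,1)] less.prems(3) 2 by simp
  next
    case 3
    obtain a b c d where "A = box a b" "B = box c d"
      using disjoint_box_union_le_1_imp_box less.prems(1,2) 3 by metis
    then show ?thesis using measure_box_sum_ge[of a b c d] less.prems(3) by simp
  qed
qed

section \<open>Inner approximation and the volume-diameter bound\<close>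

text \<open>A closed inner approximation is compact, hence covered by finitely many boxes whose
  closures lie in \<open>S\<close>. Subdividing these into closed boxes with disjoint interiors and
  keeping only the interiors loses a null set of faces.\<close>

lemma open_inner_disjoint_box_union:
  fixes S :: "'a::euclidean_space set"
  assumes S: "open S" "bounded S" and e: "e > 0"
  obtains n A where "disjoint_box_union n A" "A \<subseteq> S" "measure lebesgue S \<le> measure lebesgue A + e"
proof -
  have Sm: "S \<in> lmeasurable" using S by (rule open_bounded_lmeasurable)
  obtain T where T: "closed T" "T \<subseteq> S" "S - T \<in> lmeasurable" "emeasure lebesgue (S - T) < ennreal e"
    using sets_lebesgue_inner_closed[of S e] Sm e by blast
  have cT: "compact T" using T S bounded_subset compact_eq_bounded_closed by blast
  have "\<forall>x\<in>T. \<exists>a b. x \<in> box a b \<and> cbox a b \<subseteq> S"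
    using T(2) S(1) open_contains_cbox by (metis subsetD)
  then obtain a b where ab: "\<And>x. x \<in> T \<Longrightarrow> x \<in> box (a x) (b x) \<and> cbox (a x) (b x) \<subseteq> S" by metis
  obtain I where I: "I \<subseteq> T" "finite I" "T \<subseteq> (\<Union>x\<in>I. box (a x) (b x))"
  proof (rule compactE_image[OF cT, of T "\<lambda>x. box (a x) (b x)"])
    show "T \<subseteq> (\<Union>x\<in>T. box (a x) (b x))" using ab by auto
  qed (use that in auto)
  let ?f = "(\<lambda>x. cbox (a x) (b x)) ` I"
  obtain p where p: "p division_of \<Union>?f"
    using elementary_unions_intervals[of ?f] I(2) by blast
  let ?F = "interior ` p - {{}}"
  let ?A = "\<Union>?F"
  have fp: "finite p" using p by auto
  have "pairwise disjnt ?F"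
    using division_ofD(5)[OF p] unfolding pairwise_def disjnt_def by blast
  moreover have "B \<noteq> {} \<and> (\<exists>a b. B = box a b)" if "B \<in> ?F" for B
    using that division_ofD(4)[OF p] by (metis DiffE imageE interior_cbox singletonI)
  ultimately have bu: "disjoint_box_union (card ?F) ?A"
    using disjoint_box_unionI[of ?F "card ?F"] fp by blast
  have fS: "\<Union>?f \<subseteq> S" using ab I by blast
  have AS: "?A \<subseteq> \<Union>?f" using division_ofD(2)[OF p] interior_subset by blast
  have Am: "?A \<in> lmeasurable"
    using disjoint_box_union_open[OF bu] disjoint_box_union_bounded[OF bu] open_bounded_lmeasurable by blast
  have neg: "negligible (\<Union>?f - ?A)"
  proof (rule negligible_subset)
    show "negligible (\<Union>K\<in>p. K - interior K)"
    proof (rule negligible_Union)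
      fix U assume "U \<in> (\<lambda>K. K - interior K) ` p"
      then obtain K where "K \<in> p" "U = K - interior K" by blast
      moreover then obtain u w where "K = cbox u w" using division_ofD(4)[OF p] by blast
      ultimately show "negligible U" by (simp add: negligible_frontier_interval)
    qed (use fp in simp)
    show "\<Union>?f - ?A \<subseteq> (\<Union>K\<in>p. K - interior K)"
    proof
      fix x assume x: "x \<in> \<Union>?f - ?A"
      then have "x \<in> \<Union>p" unfolding division_ofD(6)[OF p] by simp
      then obtain K where K: "K \<in> p" "x \<in> K" by (rule UnionE)
      moreover have "x \<notin> interior K" using x K(1) by auto
      ultimately show "x \<in> (\<Union>K\<in>p. K - interior K)" by auto
    qed
  qed
  have nm: "\<Union>?f - ?A \<in> lmeasurable" using neg negligible_imp_measurable by blast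
  have "T \<subseteq> \<Union>?f" using I(3) box_subset_cbox by fastforce
  then have "S \<subseteq> ?A \<union> (\<Union>?f - ?A) \<union> (S - T)" by auto
  then have "measure lebesgue S \<le> measure lebesgue (?A \<union> (\<Union>?f - ?A) \<union> (S - T))"
    using Sm Am nm T(3) by (intro measure_mono_fmeasurable fmeasurable.Un) auto
  also have "\<dots> \<le> measure lebesgue ?A + measure lebesgue (\<Union>?f - ?A) + measure lebesgue (S - T)"
    using Am nm T(3) by (meson add_right_mono fmeasurableD fmeasurable.Un measure_Un_le order_trans)
  also have "\<dots> \<le> measure lebesgue ?A + e"
  proof -
    have "measure lebesgue (S - T) \<le> e"
      using T(3,4) e by (simp add: emeasure_eq_measure2 ennreal_less_iff)
    then show ?thesis using neg negligible_imp_measure0 by fastforce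
  qed
  finally show ?thesis using that[OF bu] AS fS by blast
qed

lemma disjoint_box_union_uminus:
  fixes A :: "'a::euclidean_space set"
  assumes "disjoint_box_union n A"
  shows "disjoint_box_union n (uminus ` A)"
proof -
  obtain F where F: "finite F" "card F \<le> n" "pairwise disjnt F"
    "\<And>B. B \<in> F \<Longrightarrow> B \<noteq> {}" "\<And>B. B \<in> F \<Longrightarrow> \<exists>a b. B = box a b" "A = \<Union>F"
    using disjoint_box_unionE[OF assms(1)] by metis
  let ?F = "(`) uminus ` F"
  have *: "uminus ` box a b = box (-b) (-a)" for a b :: 'a
  proof -
    have "x \<in> uminus ` box a b \<longleftrightarrow> - x \<in> box a b" for x
      by (metis image_iff minus_minus)
    then show ?thesis by (force simp: mem_box)
  qed
  have "card ?F \<le> n" using card_image_le[OF F(1)] F(2) order_trans by blast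
  moreover have "finite ?F" using F(1) by simp
  moreover have "pairwise disjnt ?F"
    using F(3) unfolding pairwise_def disjnt_def by (auto simp: image_iff, blast+)
  moreover have "B \<noteq> {} \<and> (\<exists>a b. B = box a b)" if "B \<in> ?F" for B using that F(4,5) * by fastforce
  moreover have "uminus ` A = \<Union>?F" using F(6) by blast
  ultimately show ?thesis using disjoint_box_unionI[of ?F n] by metis
qed

text \<open>The sum of \<open>A\<close> and \<open>- A\<close> is the difference set of
  \<open>A\<close>, which lies in the ball of radius \<open>diameter S\<close>. Since its volume is
  at least \<open>2 ^ DIM('a)\<close> times that of \<open>A\<close>, dividing by this factor turns
  the radius into half the diameter.\<close>

theorem isodiametric_inequality:
  fixes S :: "'a::euclidean_space set"
  assumes S: "open S" "bounded S"
  shows "measure lebesgue S \<le> unit_ball_vol (real DIM('a)) * (diameter S / 2) ^ DIM('a)"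
proof (rule field_le_epsilon)
  fix e :: real assume "e > 0"
  obtain n A where A: "disjoint_box_union n A" "A \<subseteq> S" "measure lebesgue S \<le> measure lebesgue A + e"
    using open_inner_disjoint_box_union[OF S \<open>e > 0\<close>] by blast
  let ?D = "{x + y |x y. x \<in> A \<and> y \<in> uminus ` A}"
  have "measure lebesgue A = measure lebesgue (uminus ` A)"
    using measure_lebesgue_affine[of "-1" 0 A] by (simp add: image_def)
  then have "2 ^ DIM('a) * measure lebesgue A \<le> measure lebesgue ?D"
    using disjoint_box_union_measure_sum_ge[OF A(1) disjoint_box_union_uminus[OF A(1)]] by blast
  also have "\<dots> \<le> measure lebesgue (cball (0::'a) (diameter S))"
  proof (rule measure_mono_fmeasurable)
    show "?D \<subseteq> cball 0 (diameter S)"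
    proof
      fix z assume "z \<in> ?D"
      then obtain x y where "x \<in> S" "y \<in> S" "z = x - y" using A(2) by fastforce
      then show "z \<in> cball 0 (diameter S)"
        using diameter_bounded_bound[OF S(2), of y x] by (simp add: dist_norm)
    qed
    have "?D = (\<Union>x\<in>A. \<Union>y\<in>uminus ` A. {x + y})" by blast
    then have "open ?D"
      using open_sums[of A "uminus ` A"] disjoint_box_union_open[OF A(1)] by simp
    then show "?D \<in> sets lebesgue" by simp
  qed auto
  also have "\<dots> = unit_ball_vol (real DIM('a)) * diameter S ^ DIM('a)"
    using diameter_ge_0[OF S(2)] by (simp add: content_cball measure_completion)
  finally have "measure lebesgue A \<le> unit_ball_vol (real DIM('a)) * (diameter S / 2) ^ DIM('a)"
    by (simp add: power_divide field_simps)
  then show "measure lebesgue S \<le> unit_ball_vol (real DIM('a)) * (diameter S / 2) ^ DIM('a) + e"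
    using A(3) by linarith
qed

section \<open>Means and powers\<close>

lemma powr_above_tangent:
  fixes s t p :: real
  assumes "1 \<le> p" "0 < s" "0 \<le> t"
  shows "s powr p + p * s powr (p - 1) * (t - s) \<le> t powr p"
\<comment> \<open>Convexity is used on the open half-line, so the endpoint is separate: there the
  claim reads \<open>(1 - p) * s powr p \<le> 0\<close>.\<close>
proof (cases "t = 0")
  case True
  have "s powr (p - 1) * s = s powr p" using assms by (simp add: powr_diff)
  then have "p * s powr (p - 1) * (t - s) = - (p * s powr p)" using True by (simp add: mult.assoc)
  moreover have "s powr p \<le> p * s powr p" using assms by simp
  ultimately show ?thesis unfolding True by (smt (verit) powr_ge_zero)
next
  case False
  have "p * s powr (p - 1) * (t - s) \<le> t powr p - s powr p"
  proof (rule convex_on_imp_above_tangent[OF powr_convex[OF assms(1)]])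
    show "((\<lambda>x. x powr p) has_real_derivative p * s powr (p - 1)) (at s within {0<..})"
      using assms by (auto intro!: derivative_eq_intros)
  qed (use assms False in \<open>auto simp: interior_open\<close>)
  then show ?thesis by simp
qed

text \<open>Integrate the tangent inequality for the power at the mean \<open>s\<close> of
  \<open>f\<close>: the linear term integrates to zero. The tangent requires \<open>0 < s\<close>;
  for \<open>s = 0\<close> the left side vanishes.\<close>

lemma avg_on_powr_le:
  assumes p: "1 \<le> p" and D: "D \<in> lmeasurable" "0 < measure lebesgue D"
    and f: "\<And>x. 0 \<le> f x" "set_integrable lebesgue D f" "set_integrable lebesgue D (\<lambda>x. f x powr p)"
  shows "avg_on D f powr p \<le> avg_on D (\<lambda>x. f x powr p)"
proof -
  define s where "s = avg_on D f"
  have s0: "0 \<le> s" unfolding s_def avg_on_def set_lebesgue_integral_def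
    by (intro divide_nonneg_nonneg Bochner_Integration.integral_nonneg) (auto simp: f)
  have cD: "set_integrable lebesgue D (\<lambda>x. c::real)" for c
    using D integrable_real_mult_indicator[of D lebesgue "\<lambda>x. c"] by (auto simp: set_integrable_def fmeasurable_def)
  show ?thesis
  proof (cases "s = 0")
    case True
    have "0 \<le> avg_on D (\<lambda>x. f x powr p)" unfolding avg_on_def set_lebesgue_integral_def
      by (intro divide_nonneg_nonneg Bochner_Integration.integral_nonneg) auto
    then show ?thesis using True s_def by simp
  next
    case False
    then have s: "0 < s" using s0 by simp
    let ?b = "p * s powr (p - 1)"
    have lin: "set_integrable lebesgue D (\<lambda>x. (s powr p - ?b * s) + ?b * f x)"
      using cD f(2) by (intro set_integral_add set_integrable_mult_right) auto
    have intf: "(LINT x:D|lebesgue. f x) = s * measure lebesgue D"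
      using D by (simp add: s_def avg_on_def)
    have "s powr p * measure lebesgue D = (LINT x:D|lebesgue. (s powr p - ?b * s) + ?b * f x)"
    proof -
      have "(LINT x:D|lebesgue. (s powr p - ?b * s) + ?b * f x)
          = (LINT x:D|lebesgue. (s powr p - ?b * s)) + (LINT x:D|lebesgue. ?b * f x)"
        using cD f(2) by (intro set_integral_add set_integrable_mult_right) auto
      also have "(LINT x:D|lebesgue. (s powr p - ?b * s)) = (s powr p - ?b * s) * measure lebesgue D"
        using D by (simp add: set_lebesgue_integral_def)
      also have "(LINT x:D|lebesgue. ?b * f x) = ?b * (s * measure lebesgue D)"
        using intf by simp
      finally show ?thesis by (simp add: algebra_simps)
    qed
    also have "\<dots> \<le> (LINT x:D|lebesgue. f x powr p)"
    proof (rule set_integral_mono[OF lin f(3)])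
      fix x assume "x \<in> D"
      show "(s powr p - ?b * s) + ?b * f x \<le> f x powr p"
        using powr_above_tangent[OF p s f(1)[of x]] by (simp add: algebra_simps)
    qed
    finally show ?thesis using D unfolding s_def[symmetric] by (simp add: avg_on_def field_simps)
  qed
qed

section \<open>Boundary oscillation of solutions\<close>

text \<open>A ball is connected, so if it contained points both inside and outside \<open>S\<close>
  it would meet the frontier, at a distance below the infimum.\<close>

lemma ball_infdist_frontier_subset:
  fixes S :: "'a::euclidean_space set"
  assumes "x \<in> S"
  shows "ball x (infdist x (frontier S)) \<subseteq> S"
proof (rule ccontr)
  let ?B = "ball x (infdist x (frontier S))"
  assume n: "\<not> ?B \<subseteq> S"
  then have "?B \<inter> frontier S \<noteq> {}"
  proof (intro connected_Int_frontier)
    have "0 < infdist x (frontier S)" using n infdist_nonneg[of x "frontier S"] by (force simp: le_less)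
    then show "?B \<inter> S \<noteq> {}" using assms centre_in_ball by blast
  qed auto
  then obtain y where "y \<in> frontier S" "dist x y < infdist x (frontier S)" by auto
  then show False using infdist_le[of y "frontier S" x] by simp
qed

lemma weak_solution_imp_subsolution: "weak_solution A \<Omega> v \<Longrightarrow> weak_subsolution A \<Omega> v"
  unfolding weak_solution_def weak_subsolution_def by auto

lemma W12_loc_grad_uminus:
  assumes "W12_loc_grad \<Omega> v g"
  shows "W12_loc_grad \<Omega> (\<lambda>x. - v x) (\<lambda>x. - g x)"
proof -
  have "set_borel_measurable lebesgue \<Omega> (\<lambda>x. - v x)" "set_borel_measurable lebesgue \<Omega> (\<lambda>x. - g x)"
    using assms unfolding W12_loc_grad_def set_borel_measurable_def by auto
  then show ?thesis
    using assms unfolding W12_loc_grad_def by (simp add: set_lebesgue_integral_def)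
qed

lemma weak_solution_uminus:
  assumes "weak_solution A \<Omega> v"
  shows "weak_solution A \<Omega> (\<lambda>x. - v x)"
proof -
  obtain g where g: "W12_loc_grad \<Omega> v g"
    "\<And>\<phi>. test_fun \<Omega> \<phi> \<Longrightarrow> (LINT x:\<Omega>|lebesgue. (A x *v g x) \<bullet> grad \<phi> x) = 0"
    using assms unfolding weak_solution_def by blast
  have "A x *v (- g x) = - (A x *v g x)" for x
    using linear_neg[OF matrix_vector_mul_linear[of "A x"]] by simp
  then have "(LINT x:\<Omega>|lebesgue. (A x *v (- g x)) \<bullet> grad \<phi> x) = 0" if "test_fun \<Omega> \<phi>" for \<phi>
    using g(2)[OF that] by (simp add: set_lebesgue_integral_def)
  then show ?thesis using W12_loc_grad_uminus[OF g(1)] unfolding weak_solution_def by blast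
qed

section \<open>Hoelder continuity and the scaled seminorm\<close>

lemma holder_on_imp_continuous_on:
  assumes "holder_on \<alpha> S v" "0 < \<alpha>"
  shows "continuous_on S v"
proof -
  obtain M where M: "\<And>x y. x \<in> S \<Longrightarrow> y \<in> S \<Longrightarrow> \<bar>v x - v y\<bar> \<le> M * dist x y powr \<alpha>"
    using assms unfolding holder_on_def by blast
  show ?thesis
    unfolding continuous_on_def
  proof
    fix x assume x: "x \<in> S"
    have "((\<lambda>y. M * dist y x powr \<alpha>) \<longlongrightarrow> M * 0 powr \<alpha>) (at x within S)"
      by (intro tendsto_mult tendsto_const tendsto_powr' tendsto_dist_iff[THEN iffD1] tendsto_ident_at)
        (use assms in auto)
    then have "((\<lambda>y. M * dist y x powr \<alpha>) \<longlongrightarrow> 0) (at x within S)" by simp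
    then have "((\<lambda>y. v y - v x) \<longlongrightarrow> 0) (at x within S)"
    proof (rule Lim_null_comparison[rotated])
      show "\<forall>\<^sub>F y in at x within S. norm (v y - v x) \<le> M * dist y x powr \<alpha>"
        using M x by (auto simp: eventually_at_filter)
    qed
    then show "(v \<longlongrightarrow> v x) (at x within S)" by (simp add: LIM_zero_iff)
  qed
qed

text \<open>A Hoelder constant bounds the quotients, so their supremum really dominates each of
  them. Positivity of the diameter allows the scaling weight to be moved to the other side.\<close>

lemma holder_semi_bound:
  assumes h: "holder_on \<alpha> (closure \<Omega>) v" and d: "0 < diameter \<Omega>" and \<alpha>: "0 < \<alpha>"
    and x: "x \<in> closure \<Omega>" "y \<in> closure \<Omega>"
  shows "\<bar>v x - v y\<bar> \<le> holder_semi \<alpha> \<Omega> v * (2 * dist x y / diameter \<Omega>) powr \<alpha>"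
proof (cases "x = y")
  case True then show ?thesis by simp
next
  case False
  let ?X = "{(diameter \<Omega> / 2) powr \<alpha> * \<bar>v x1 - v x2\<bar> / dist x1 x2 powr \<alpha> | x1 x2.
       x1 \<in> closure \<Omega> \<and> x2 \<in> closure \<Omega> \<and> x1 \<noteq> x2}"
  obtain M where M: "\<And>x y. x \<in> closure \<Omega> \<Longrightarrow> y \<in> closure \<Omega> \<Longrightarrow> \<bar>v x - v y\<bar> \<le> M * dist x y powr \<alpha>"
    using h unfolding holder_on_def by blast
  have "bdd_above ?X"
  proof (rule bdd_aboveI)
    fix u assume "u \<in> ?X"
    then obtain x1 x2 where u: "u = (diameter \<Omega> / 2) powr \<alpha> * \<bar>v x1 - v x2\<bar> / dist x1 x2 powr \<alpha>"
      "x1 \<in> closure \<Omega>" "x2 \<in> closure \<Omega>" "x1 \<noteq> x2" by blast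
    have "\<bar>v x1 - v x2\<bar> / dist x1 x2 powr \<alpha> \<le> M"
      using M[OF u(2,3)] u(4) by (simp add: divide_simps)
    then show "u \<le> (diameter \<Omega> / 2) powr \<alpha> * M"
      unfolding u(1) times_divide_eq_right[symmetric] by (rule mult_left_mono) simp
  qed
  then have "(diameter \<Omega> / 2) powr \<alpha> * \<bar>v x - v y\<bar> / dist x y powr \<alpha> \<le> holder_semi \<alpha> \<Omega> v"
    unfolding holder_semi_def by (intro cSup_upper) (use x False in blast)+
  moreover have "(2 * dist x y / diameter \<Omega>) powr \<alpha> = dist x y powr \<alpha> / (diameter \<Omega> / 2) powr \<alpha>"
    using d by (simp add: powr_divide[symmetric] field_simps)
  moreover have "0 < (diameter \<Omega> / 2) powr \<alpha>" "0 < dist x y powr \<alpha>" using d False by auto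
  ultimately show ?thesis by (simp add: pos_le_divide_eq pos_divide_le_eq mult.commute)
qed

lemma diameter_open_pos:
  fixes S :: "'a::euclidean_space set"
  assumes "open S" "bounded S" "S \<noteq> {}"
  shows "0 < diameter S"
proof -
  obtain x e where "e > 0" "ball x e \<subseteq> S" using assms open_contains_ball by blast
  then show ?thesis using diameter_subset[of "ball x e" S] assms(2) by auto
qed

lemma holder_semi_nonneg:
  assumes h: "holder_on \<alpha> (closure \<Omega>) v" and d: "0 < diameter \<Omega>" and \<alpha>: "0 < \<alpha>"
  shows "0 \<le> holder_semi \<alpha> \<Omega> v"
proof -
  \<comment> \<open>A positive diameter provides two distinct points, so the supremum is not taken
    over the empty set.\<close>
  obtain x y where xy: "x \<in> \<Omega>" "y \<in> \<Omega>" "x \<noteq> y"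
  proof (rule ccontr)
    assume "\<not> thesis"
    then have "\<Omega> = {} \<or> (\<exists>x. \<Omega> = {x})" using that by blast
    then show False using d by auto
  qed
  then have "0 \<le> holder_semi \<alpha> \<Omega> v * (2 * dist x y / diameter \<Omega>) powr \<alpha>"
    using holder_semi_bound[OF h d \<alpha>, of x y] closure_subset by fastforce
  moreover have "0 < (2 * dist x y / diameter \<Omega>) powr \<alpha>" using xy d by simp
  ultimately show ?thesis by (simp add: zero_le_mult_iff)
qed

section \<open>Pointwise bounds from the mean value property\<close>

text \<open>After Jensen on the averaging set \<open>D\<close>, the integral is enlarged to
  \<Omega>. The ratio of volumes is controlled by a ball of radius \<open>c * s\<close> inside
  \<open>D\<close> and by a ball of half the diameter as an upper bound for \<Omega>. The number
  \<open>m\<close> is arbitrary.\<close>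

lemma subsolution_interior_bound:
  fixes \<Omega> :: "(real^'n) set"
  assumes mvp: "mean_value_property A \<Omega> c C" and p: "1 \<le> p"
    and dom: "open \<Omega>" "bounded \<Omega>"
    and v: "continuous_on (closure \<Omega>) v" "weak_subsolution A \<Omega> v"
    and x0: "x0 \<in> \<Omega>" and s: "0 < s" "s < infdist x0 (frontier \<Omega>) / C"
  shows "v x0 - m \<le> (diameter \<Omega> / (2 * c * s)) powr (CARD('n) / p) * lp_norm_normalized p \<Omega> (\<lambda>x. v x - m)"
proof -
  have cC: "0 < c" "c \<le> C" using mvp unfolding mean_value_property_def by auto
  have d: "0 < diameter \<Omega>" using diameter_open_pos[OF dom] x0 by blast
  \<comment> \<open>The mean value inequality is stated for pairs of radii, so a larger admissible
    radius is needed to extract it at \<open>s\<close>.\<close>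
  obtain \<rho> where \<rho>: "s < \<rho>" "\<rho> < infdist x0 (frontier \<Omega>) / C" using s(2) dense by blast
  obtain D where D: "D \<in> sets lebesgue" "ball x0 (c * s) \<subseteq> D" "D \<subseteq> ball x0 (C * s)"
    "v x0 \<le> avg_on D v"
  proof -
    have c: "continuous_on \<Omega> v" by (rule continuous_on_subset[OF v(1) closure_subset])
    obtain D where D: "\<forall>x0\<in>\<Omega>.
        (\<forall>r. 0 < r \<and> r < infdist x0 (frontier \<Omega>) / C \<longrightarrow>
            D x0 r \<in> sets lebesgue \<and> ball x0 (c * r) \<subseteq> D x0 r \<and> D x0 r \<subseteq> ball x0 (C * r)) \<and>
        (\<forall>r \<rho>. 0 < r \<and> r < \<rho> \<and> \<rho> < infdist x0 (frontier \<Omega>) / C \<longrightarrow>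
            D x0 r \<subseteq> D x0 \<rho> \<and>
            (\<forall>v. continuous_on \<Omega> v \<and> weak_subsolution A \<Omega> v \<longrightarrow>
                v x0 \<le> avg_on (D x0 r) v \<and> avg_on (D x0 r) v \<le> avg_on (D x0 \<rho>) v))"
      using mvp unfolding mean_value_property_def by (elim conjE exE) (rule that)
    show ?thesis
    proof (rule that[of "D x0 s"])
      show "D x0 s \<in> sets lebesgue" "ball x0 (c * s) \<subseteq> D x0 s" "D x0 s \<subseteq> ball x0 (C * s)"
        using D x0 s by simp_all
      show "v x0 \<le> avg_on (D x0 s) v"
        using D[rule_format, OF x0, THEN conjunct2, rule_format, of s \<rho>] s \<rho> v(2) c by blast
    qed
  qed
  have "C * s \<le> infdist x0 (frontier \<Omega>)" using s(2) cC by (simp add: field_simps)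
  then have D\<Omega>: "D \<subseteq> \<Omega>"
    using D(3) ball_infdist_frontier_subset[OF x0] by (meson order_trans subset_ball)
  have \<Omega>m: "\<Omega> \<in> lmeasurable" using dom by (rule open_bounded_lmeasurable)
  have Dm: "D \<in> lmeasurable" using D(1) D\<Omega> \<Omega>m fmeasurableI2 by blast
  let ?N = "CARD('n)" and ?\<omega> = "unit_ball_vol (real CARD('n))"
  have Dlow: "?\<omega> * (c * s) ^ ?N \<le> measure lebesgue D"
  proof -
    have "measure lebesgue (ball x0 (c * s)) \<le> measure lebesgue D"
      by (rule measure_mono_fmeasurable[OF D(2) _ Dm]) simp
    then show ?thesis using cC s by (simp add: measure_completion content_ball)
  qed
  have Dlow0: "0 < ?\<omega> * (c * s) ^ ?N" using cC s by simp
  have Dpos: "0 < measure lebesgue D" using Dlow Dlow0 by linarith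
  have cl: "compact (closure \<Omega>)" using dom by (simp add: compact_closure)
  have int: "set_integrable lebesgue U f" if "continuous_on (closure \<Omega>) f" "U \<subseteq> \<Omega>" "U \<in> sets lebesgue"
    for f :: "real^'n \<Rightarrow> real" and U
  proof -
    have "set_integrable lborel (closure \<Omega>) f"
      using borel_integrable_compact[OF cl that(1)] by (simp add: set_integrable_def indicator_scaleR_eq_if)
    then have "set_integrable lebesgue (closure \<Omega>) f"
      unfolding set_integrable_def by (simp add: integrable_completion borel_measurable_integrable)
    then show ?thesis
      by (rule set_integrable_subset) (use that closure_subset in auto)
  qed
  \<comment> \<open>The absolute value makes Jensen's inequality for powers applicable, while
    \<open>v x - m \<le> w x\<close> keeps the upper bound.\<close>
  define w where "w x = \<bar>v x - m\<bar>" for x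
  have w: "continuous_on (closure \<Omega>) w" "continuous_on (closure \<Omega>) (\<lambda>x. w x powr p)"
    unfolding w_def using v(1) p by (auto intro!: continuous_intros continuous_on_powr')
  have \<Omega>s: "\<Omega> \<in> sets lebesgue" using \<Omega>m by auto
  let ?I = "LINT x:\<Omega>|lebesgue. w x powr p"
  have I: "(LINT x:D|lebesgue. w x powr p) \<le> ?I"
    unfolding set_lebesgue_integral_def
    by (rule integral_mono; (use int[OF w(2) D\<Omega> D(1)] int[OF w(2) order_refl \<Omega>s] in \<open>simp add: set_integrable_def\<close>)?)
      (use D\<Omega> in \<open>auto simp: indicator_def\<close>)
  have I0: "0 \<le> ?I" unfolding set_lebesgue_integral_def by (intro Bochner_Integration.integral_nonneg) auto
  have "v x0 - m \<le> avg_on D w"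
  proof -
    have iv: "set_integrable lebesgue D v" and iw: "set_integrable lebesgue D w"
      using int D\<Omega> D(1) v(1) w(1) by auto
    have im: "set_integrable lebesgue D (\<lambda>x. m)" using int[OF _ D\<Omega> D(1)] by auto
    have "(LINT x:D|lebesgue. v x) - m * measure lebesgue D = (LINT x:D|lebesgue. v x) - (LINT x:D|lebesgue. m)"
      using Dm by (simp add: set_lebesgue_integral_def)
    also have "\<dots> = (LINT x:D|lebesgue. v x - m)" using set_integral_diff(2)[OF iv im] by simp
    also have "\<dots> \<le> (LINT x:D|lebesgue. w x)"
      by (rule set_integral_mono[OF set_integral_diff(1)[OF iv im] iw]) (simp add: w_def)
    finally have "((LINT x:D|lebesgue. v x) - m * measure lebesgue D) / measure lebesgue D \<le> avg_on D w"
      unfolding avg_on_def using Dpos by (simp add: divide_right_mono)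
    then have "avg_on D v - m \<le> avg_on D w"
      using Dpos by (simp add: avg_on_def diff_divide_distrib)
    then show ?thesis using D(4) by simp
  qed
  also have "avg_on D w = (avg_on D w powr p) powr (1 / p)"
  proof -
    have "0 \<le> avg_on D w" unfolding avg_on_def set_lebesgue_integral_def
      by (intro divide_nonneg_nonneg Bochner_Integration.integral_nonneg) (auto simp: w_def)
    then show ?thesis using p by (simp add: powr_powr)
  qed
  also have "\<dots> \<le> (?I / measure lebesgue \<Omega> * (diameter \<Omega> / (2 * c * s)) ^ ?N) powr (1 / p)"
  proof (rule powr_mono2)
    have "avg_on D w powr p \<le> avg_on D (\<lambda>x. w x powr p)"
      by (rule avg_on_powr_le[OF p Dm Dpos]) (use int[OF w(1) D\<Omega> D(1)] int[OF w(2) D\<Omega> D(1)] w_def in auto)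
    also have "\<dots> \<le> ?I / measure lebesgue D"
      unfolding avg_on_def using I Dpos by (simp add: divide_right_mono)
    also have "\<dots> \<le> ?I / (?\<omega> * (c * s) ^ ?N)"
      using I0 Dlow Dlow0 by (intro divide_left_mono) auto
    \<comment> \<open>The unit-ball volume is inserted on both sides of the quotient so that the
      isodiametric inequality can replace the denominator by the volume of \<Omega>.\<close>
    also have "\<dots> = ?I / (?\<omega> * (diameter \<Omega> / 2) ^ ?N) * (diameter \<Omega> / (2 * c * s)) ^ ?N"
      using d cC s by (simp add: power_divide power_mult_distrib)
    also have "\<dots> \<le> ?I / measure lebesgue \<Omega> * (diameter \<Omega> / (2 * c * s)) ^ ?N"
    proof (rule mult_right_mono)
      have "0 < measure lebesgue \<Omega>"
        using Dpos measure_mono_fmeasurable[OF D\<Omega> D(1) \<Omega>m] by linarith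
      moreover have "measure lebesgue \<Omega> \<le> ?\<omega> * (diameter \<Omega> / 2) ^ ?N"
        using isodiametric_inequality[OF dom] by simp
      ultimately show "?I / (?\<omega> * (diameter \<Omega> / 2) ^ ?N) \<le> ?I / measure lebesgue \<Omega>"
        using I0 by (intro divide_left_mono) auto
      show "0 \<le> (diameter \<Omega> / (2 * c * s)) ^ ?N"
        using d cC s by (intro zero_le_power) auto
    qed
    finally show "avg_on D w powr p \<le> ?I / measure lebesgue \<Omega> * (diameter \<Omega> / (2 * c * s)) ^ ?N" .
  qed (use p in auto)
  also have "\<dots> = (diameter \<Omega> / (2 * c * s)) powr (?N / p) * lp_norm_normalized p \<Omega> (\<lambda>x. v x - m)"
  proof -
    have q: "0 < diameter \<Omega> / (2 * c * s)" using d cC s by auto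
    have 1: "((diameter \<Omega> / (2 * c * s)) ^ ?N) powr (1 / p) = (diameter \<Omega> / (2 * c * s)) powr (?N / p)"
      using q by (simp add: powr_realpow[symmetric] powr_powr)
    have 2: "lp_norm_normalized p \<Omega> (\<lambda>x. v x - m) = (?I / measure lebesgue \<Omega>) powr (1 / p)"
      by (simp add: lp_norm_normalized_def w_def)
    show ?thesis
      unfolding 2 1[symmetric] powr_mult by (rule mult.commute)
  qed
  finally show ?thesis .
qed

text \<open>Split \<open>v x - m\<close> at the interior point \<open>xr\<close> from the John
  condition: the first part is a Hoelder increment over distance below \<open>r\<close>, the second
  is the interior bound. Everything is expressed through the scale
  \<open>2 * r / diameter \<Omega>\<close>.\<close>

lemma subsolution_boundary_bound:
  fixes \<Omega> :: "(real^'n) set"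
  assumes mvp: "mean_value_property A \<Omega> c C" and p: "1 \<le> p" and \<alpha>: "0 < \<alpha>"
    and dom: "open \<Omega>" "bounded \<Omega>" and john: "local_John b0 R \<Omega>"
    and v: "holder_on \<alpha> (closure \<Omega>) v" "weak_subsolution A \<Omega> v"
    and x: "x \<in> frontier \<Omega>" and r: "0 < r" "r \<le> R"
  shows "v x - m \<le> holder_semi \<alpha> \<Omega> v * (2 * r / diameter \<Omega>) powr \<alpha>
    + (C * b0 / c / (2 * r / diameter \<Omega>)) powr (CARD('n) / p) * lp_norm_normalized p \<Omega> (\<lambda>x. v x - m)"
proof -
  have cC: "0 < c" "0 < C" using mvp unfolding mean_value_property_def by auto
  have b0: "1 < b0" using john unfolding local_John_def by auto
  obtain xr where xr: "xr \<in> ball x r" "xr \<in> \<Omega>" "ball xr (r / b0) \<subseteq> \<Omega>"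
    using john x r unfolding local_John_def by blast
  have d: "0 < diameter \<Omega>" using diameter_open_pos[OF dom] xr by auto
  have xcl: "x \<in> closure \<Omega>" using x by (simp add: frontier_def)
  have "v x - v xr \<le> holder_semi \<alpha> \<Omega> v * (2 * dist x xr / diameter \<Omega>) powr \<alpha>"
    using holder_semi_bound[OF v(1) d \<alpha> xcl, of xr] xr(2) closure_subset by fastforce
  also have "\<dots> \<le> holder_semi \<alpha> \<Omega> v * (2 * r / diameter \<Omega>) powr \<alpha>"
    using xr(1) d \<alpha> holder_semi_nonneg[OF v(1) d \<alpha>]
    by (intro mult_left_mono powr_mono2) (auto intro!: divide_right_mono)
  finally have 1: "v x - v xr \<le> holder_semi \<alpha> \<Omega> v * (2 * r / diameter \<Omega>) powr \<alpha>" .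
  have inf: "r / b0 \<le> infdist xr (frontier \<Omega>)"
  proof -
    have "r / b0 \<le> dist xr y" if "y \<in> frontier \<Omega>" for y
    proof (rule ccontr)
      assume "\<not> r / b0 \<le> dist xr y"
      then have "y \<in> \<Omega>" using xr(3) by auto
      then show False using that dom(1) by (simp add: frontier_def interior_open)
    qed
    then show ?thesis using x by (auto simp: infdist_def intro!: cINF_greatest)
  qed
  let ?M = "lp_norm_normalized p \<Omega> (\<lambda>x. v x - m)"
  let ?f = "\<lambda>s. (diameter \<Omega> / (2 * c * s)) powr (CARD('n) / p) * ?M"
  \<comment> \<open>\<open>?s0\<close> is the limiting radius guaranteed by the distance
    \<open>r / b0\<close> of \<open>xr\<close> to the frontier. The interior bound needs a strict
    inequality, so its value at \<open>?s0\<close> is reached as a limit from the left.\<close>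
  let ?s0 = "r / b0 / C"
  have s0: "0 < ?s0" using r b0 cC by simp
  have cont: "continuous_on (closure \<Omega>) v" using holder_on_imp_continuous_on[OF v(1) \<alpha>] .
  have bd: "v xr - m \<le> ?f s" if s: "0 < s" "s < ?s0" for s
  proof (rule subsolution_interior_bound[OF mvp p dom cont v(2) xr(2) s(1)])
    show "s < infdist xr (frontier \<Omega>) / C"
      using s(2) inf cC by (meson divide_right_mono less_imp_le order_less_le_trans)
  qed
  have "v xr - m \<le> ?f ?s0"
  proof (rule tendsto_lowerbound)
    show "(?f \<longlongrightarrow> ?f ?s0) (at_left ?s0)"
      using s0 cC d by (intro tendsto_intros) auto
    show "\<forall>\<^sub>F s in at_left ?s0. v xr - m \<le> ?f s"
      using eventually_at_left_real[OF s0] by eventually_elim (use bd in auto)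
  qed simp
  also have "diameter \<Omega> / (2 * c * ?s0) = C * b0 / c / (2 * r / diameter \<Omega>)"
    using cC b0 r d by (simp add: field_simps)
  finally show ?thesis using 1 by simp
qed

section \<open>Optimisation in the scale and the final estimate\<close>

text \<open>The sum in \<open>bound\<close> is minimised over all positive \<rho>. If the minimiser
  is at most \<open>\<rho>0\<close>, the first entry of the maximum results; otherwise
  \<open>H\<close> is already controlled by its value at the minimiser and \<open>crude\<close>
  yields the second entry.\<close>

lemma interpolation_optimise:
  fixes N p \<alpha> H M k \<rho>0 b osc :: real
  assumes pos: "0 < N" "0 < p" "0 < \<alpha>" "0 < k" "0 < \<rho>0" "1 \<le> b" "0 \<le> H" "0 \<le> M"
    and crude: "osc \<le> 2 powr \<alpha> * H"
    and bound: "\<And>\<rho>. 0 < \<rho> \<Longrightarrow> \<rho> \<le> \<rho>0 \<Longrightarrow> osc \<le> 2 * (H * \<rho> powr \<alpha> + (k / \<rho>) powr (N / p) * M)"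
  shows "osc \<le> max (2 * (1 + \<alpha> * p / N)) ((2 * b / \<rho>0) powr \<alpha>)
     * (N / (\<alpha> * p)) powr (\<alpha> * p / (N + \<alpha> * p)) * k powr (\<alpha> * N / (N + \<alpha> * p))
     * H powr (N / (N + \<alpha> * p)) * M powr (\<alpha> * p / (N + \<alpha> * p))"
proof -
  \<comment> \<open>The minimiser exists only for positive \<open>H\<close> and \<open>M\<close>. If
    either vanishes, so does the right side since \<open>0 powr x = 0\<close>; then
    \<open>osc \<le> 0\<close> comes from \<open>crude\<close> or from letting \<rho> tend to
    zero.\<close>
  consider "H = 0" | "M = 0" | "0 < H" "0 < M" using pos by linarith
  then show ?thesis
  proof cases
    case 1
    then show ?thesis using crude by simp
  next
    case 2
    have "osc \<le> 2 * (H * 0)"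
    proof (rule tendsto_lowerbound)
      have "((\<lambda>\<rho>. \<rho> powr \<alpha>) \<longlongrightarrow> 0 powr \<alpha>) (at_right (0::real))"
        by (rule tendsto_powr')
          (use pos in \<open>auto intro: tendsto_ident_at eventually_mono[OF eventually_at_right_less]\<close>)
      then show "((\<lambda>\<rho>. 2 * (H * \<rho> powr \<alpha>)) \<longlongrightarrow> 2 * (H * 0)) (at_right 0)"
        by (intro tendsto_mult tendsto_const) simp
      show "\<forall>\<^sub>F \<rho> in at_right 0. osc \<le> 2 * (H * \<rho> powr \<alpha>)"
        using eventually_at_right_real[OF pos(5)]
        by eventually_elim (use bound 2 in force)
    qed simp
    then show ?thesis using 2 by simp
  next
    case 3
    define a where "a = N + \<alpha> * p"
    have a: "0 < a" using pos by (simp add: a_def add_pos_pos)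
    \<comment> \<open>\<open>L\<close> is the logarithm of the stationary point of
      \<open>H * \<rho> powr \<alpha> + (k / \<rho>) powr (N / p) * M\<close>. Stationarity says
      that the second term is \<open>\<alpha> * p / N\<close> times the first, which is
      \<open>snd\<close>.\<close>
    define L where "L = (p * (ln (N / (\<alpha> * p)) + ln M - ln H) + N * ln k) / a"
    define \<rho> where "\<rho> = exp L"
    define X where "X = H * \<rho> powr \<alpha>"
    have X0: "0 < X" using 3 by (simp add: X_def \<rho>_def)
    have lnX: "ln X = ln H + \<alpha> * L" using 3 by (simp add: X_def \<rho>_def ln_mult ln_powr)
    have aL: "a * L = p * (ln (N / (\<alpha> * p)) + ln M - ln H) + N * ln k"
      using a by (simp add: L_def)
    have snd: "(k / \<rho>) powr (N / p) * M = \<alpha> * p / N * X"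
    proof -
      have "ln ((k / \<rho>) powr (N / p) * M) = N / p * (ln k - L) + ln M"
        using pos 3 by (simp add: \<rho>_def ln_mult ln_powr ln_div)
      also have "\<dots> = - ln (N / (\<alpha> * p)) + ln H + \<alpha> * L"
        using aL pos by (simp add: a_def field_simps)
      also have "\<dots> = ln (\<alpha> * p / N * X)"
        using lnX X0 pos by (simp add: ln_mult ln_div)
      finally show ?thesis using pos 3 X0 by (simp add: \<rho>_def)
    qed
    have XX: "X = (N / (\<alpha> * p)) powr (\<alpha> * p / a) * k powr (\<alpha> * N / a) * H powr (N / a) * M powr (\<alpha> * p / a)"
      (is "X = ?Y")
    proof -
      have Y0: "0 < ?Y" using pos 3 by simp
      have "ln ?Y = \<alpha> * p / a * ln (N / (\<alpha> * p)) + \<alpha> * N / a * ln k + N / a * ln H + \<alpha> * p / a * ln M"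
        using pos 3 by (simp add: ln_mult ln_powr)
      also have "\<dots> = ln H + \<alpha> * L"
      proof -
        have "N / a = 1 - \<alpha> * p / a" using a by (simp add: a_def field_simps)
        then have "N / a * ln H = ln H - \<alpha> * p / a * ln H" by (simp add: left_diff_distrib)
        then show ?thesis by (simp add: L_def add_divide_distrib diff_divide_distrib algebra_simps)
      qed
      finally show ?thesis using Y0 X0 lnX by (metis ln_inj_iff)
    qed
    let ?m = "max (2 * (1 + \<alpha> * p / N)) ((2 * b / \<rho>0) powr \<alpha>)"
    have "osc \<le> ?m * X"
    proof (cases "\<rho> \<le> \<rho>0")
      case True
      then have "osc \<le> 2 * (X + (k / \<rho>) powr (N / p) * M)"
        using bound[of \<rho>] by (simp add: X_def \<rho>_def)
      also have "\<dots> = 2 * (1 + \<alpha> * p / N) * X" unfolding snd by (simp add: algebra_simps)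
      also have "\<dots> \<le> ?m * X" using X0 by (intro mult_right_mono) auto
      finally show ?thesis .
    next
      case False
      have "osc \<le> 2 powr \<alpha> * H" by (rule crude)
      also have "\<dots> \<le> (2 * b / \<rho>0 * \<rho>) powr \<alpha> * H"
      proof (intro mult_right_mono powr_mono2)
        \<comment> \<open>Here \<rho> exceeds \<open>\<rho>0\<close> and \<open>b\<close> is at
          least one, so the base of the power is at least 2.\<close>
        have "2 \<le> 2 / \<rho>0 * \<rho>" using False pos by (simp add: field_simps)
        also have "\<dots> \<le> 2 * b / \<rho>0 * \<rho>"
          using pos by (intro mult_right_mono divide_right_mono) (auto simp: \<rho>_def)
        finally show "2 \<le> 2 * b / \<rho>0 * \<rho>" .
      qed (use pos in auto)
      also have "\<dots> = (2 * b / \<rho>0) powr \<alpha> * X"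
        using pos powr_mult[of "2 * b / \<rho>0" \<rho> \<alpha>] by (simp add: X_def \<rho>_def)
      also have "\<dots> \<le> ?m * X" using X0 by (intro mult_right_mono) auto
      finally show ?thesis .
    qed
    then show ?thesis unfolding XX a_def by (simp add: mult.assoc)
  qed
qed

lemma holder_semi_uminus: "holder_semi \<alpha> \<Omega> (\<lambda>x. - v x) = holder_semi \<alpha> \<Omega> v"
proof -
  have "\<bar>- v x - - v y\<bar> = \<bar>v x - v y\<bar>" for x y by simp
  then show ?thesis unfolding holder_semi_def by presburger
qed

text \<open>The upper bounds for \<open>v - m\<close> at a maximum point and for
  \<open>- v + m\<close> at a minimum point are added, so \<open>m\<close> cancels and may be any
  real number.\<close>

lemma solution_boundary_oscillation:
  fixes A :: "real^'n \<Rightarrow> real^'n^'n" and \<Omega> :: "(real^'n) set" and c C p \<alpha> b0 R m :: real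
  assumes mvp: "mean_value_property A \<Omega> c C" and p: "1 \<le> p" and \<alpha>: "0 < \<alpha>"
    and dom: "open \<Omega>" "bounded \<Omega>" "\<Omega> \<noteq> {}" and john: "local_John b0 R \<Omega>"
    and v: "v \<in> Sigma_sol A \<alpha> \<Omega>"
  shows "Sup (v ` frontier \<Omega>) - Inf (v ` frontier \<Omega>)
     \<le> max (2 * (1 + \<alpha> * p / CARD('n))) ((diameter \<Omega> * b0 / R) powr \<alpha>)
      * (CARD('n) / (\<alpha> * p)) powr (\<alpha> * p / (CARD('n) + \<alpha> * p))
      * (C * b0 / c) powr (\<alpha> * CARD('n) / (CARD('n) + \<alpha> * p))
      * holder_semi \<alpha> \<Omega> v powr (CARD('n) / (CARD('n) + \<alpha> * p))
      * lp_norm_normalized p \<Omega> (\<lambda>x. v x - m) powr (\<alpha> * p / (CARD('n) + \<alpha> * p))"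
proof -
  have h: "holder_on \<alpha> (closure \<Omega>) v" and sol: "weak_solution A \<Omega> v"
    using v unfolding Sigma_sol_def by auto
  have h': "holder_on \<alpha> (closure \<Omega>) (\<lambda>x. - v x)"
    using h unfolding holder_on_def by (simp add: abs_minus_commute)
  have b0R: "1 < b0" "0 < R" using john unfolding local_John_def by auto
  have cC: "0 < c" "0 < C" using mvp unfolding mean_value_property_def by auto
  have d: "0 < diameter \<Omega>" using diameter_open_pos[OF dom] .
  let ?H = "holder_semi \<alpha> \<Omega> v" and ?M = "lp_norm_normalized p \<Omega> (\<lambda>x. v x - m)"
  have H0: "0 \<le> ?H" by (rule holder_semi_nonneg[OF h d \<alpha>])
  have M': "lp_norm_normalized p \<Omega> (\<lambda>x. - v x - - m) = ?M"
  proof -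
    have "\<bar>- v x - - m\<bar> = \<bar>v x - m\<bar>" for x by simp
    then show ?thesis unfolding lp_norm_normalized_def by presburger
  qed
  have fcl: "frontier \<Omega> \<subseteq> closure \<Omega>" by (simp add: frontier_def)
  have fne: "frontier \<Omega> \<noteq> {}" using dom frontier_not_empty[of \<Omega>] not_bounded_UNIV by blast
  have fcomp: "compact (v ` frontier \<Omega>)"
    by (intro compact_continuous_image compact_frontier_bounded dom
        continuous_on_subset[OF holder_on_imp_continuous_on[OF h \<alpha>] fcl])
  obtain x where x: "x \<in> frontier \<Omega>" "Sup (v ` frontier \<Omega>) = v x"
  proof -
    obtain x where "x \<in> frontier \<Omega>" "\<forall>z\<in>v ` frontier \<Omega>. z \<le> v x"
      using compact_attains_sup[OF fcomp] fne by auto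
    then show ?thesis using that[of x] cSup_eq_maximum[of "v x" "v ` frontier \<Omega>"] by blast
  qed
  obtain y where y: "y \<in> frontier \<Omega>" "Inf (v ` frontier \<Omega>) = v y"
  proof -
    obtain y where "y \<in> frontier \<Omega>" "\<forall>z\<in>v ` frontier \<Omega>. v y \<le> z"
      using compact_attains_inf[OF fcomp] fne by auto
    then show ?thesis using that[of y] cInf_eq_minimum[of "v y" "v ` frontier \<Omega>"] by blast
  qed
  \<comment> \<open>This brings the constant into the form of the optimisation lemma, with largest
    scale \<open>2 * R / diameter \<Omega>\<close>, which corresponds to the radius
    \<open>R\<close>.\<close>
  have eq: "diameter \<Omega> * b0 / R = 2 * b0 / (2 * R / diameter \<Omega>)" using d b0R by simp
  show ?thesis unfolding x(2) y(2) eq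
  proof (rule interpolation_optimise)
    show "v x - v y \<le> 2 powr \<alpha> * ?H"
    proof -
      have "v x - v y \<le> ?H * (2 * dist x y / diameter \<Omega>) powr \<alpha>"
        using holder_semi_bound[OF h d \<alpha>, of x y] x y fcl by fastforce
      also have "\<dots> \<le> ?H * 2 powr \<alpha>"
      proof (intro mult_left_mono powr_mono2 H0)
        have "dist x y \<le> diameter \<Omega>"
          using diameter_bounded_bound[of "closure \<Omega>" x y] x y fcl dom
          by (auto simp: diameter_closure)
        then show "2 * dist x y / diameter \<Omega> \<le> 2" using d by (simp add: divide_simps)
      qed (use \<alpha> d in auto)
      finally show ?thesis by (simp add: mult.commute)
    qed
    fix \<rho> :: real assume \<rho>: "0 < \<rho>" "\<rho> \<le> 2 * R / diameter \<Omega>"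
    let ?r = "\<rho> * diameter \<Omega> / 2"
    have r: "0 < ?r" "?r \<le> R" "2 * ?r / diameter \<Omega> = \<rho>" using \<rho> d by (auto simp: field_simps)
    let ?B = "?H * \<rho> powr \<alpha> + (C * b0 / c / \<rho>) powr (CARD('n) / p) * ?M"
    have "v x - m \<le> ?B"
      using subsolution_boundary_bound[OF mvp p \<alpha> dom(1,2) john h weak_solution_imp_subsolution[OF sol] x(1) r(1,2), of m]
      unfolding r(3) .
    \<comment> \<open>Replacing \<open>v\<close> and \<open>m\<close> by their negatives changes
      neither the seminorm nor the normalized norm, so the same right side \<open>?B\<close>
      appears.\<close>
    moreover have "- v y - - m \<le> ?B"
      using subsolution_boundary_bound[OF mvp p \<alpha> dom(1,2) john h'
          weak_solution_imp_subsolution[OF weak_solution_uminus[OF sol]] y(1) r(1,2), of "- m"]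
      unfolding r(3) M' holder_semi_uminus .
    ultimately show "v x - v y \<le> 2 * ?B" by simp
  qed (use p \<alpha> cC b0R d H0 in \<open>auto simp: lp_norm_normalized_def\<close>)
qed

theorem theorem3p2:
  fixes A :: "real^'n \<Rightarrow> real^'n^'n" and \<Omega> :: "(real^'n) set"
    and lam Lam c C p \<alpha> b0 R :: real
  assumes dim: "CARD('n) \<ge> 2"
    and sym: "\<forall>x. transpose (A x) = A x"
    and meas: "\<forall>i j. (\<lambda>x. A x $ i $ j) \<in> borel_measurable lebesgue"
    and ell_pos: "0 < lam" "0 < Lam"
    and ell: "\<forall>x \<xi>. lam * (norm \<xi>)\<^sup>2 \<le> \<xi> \<bullet> (A x *v \<xi>) \<and> \<xi> \<bullet> (A x *v \<xi>) \<le> Lam * (norm \<xi>)\<^sup>2"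
    and mvp: "mean_value_property A \<Omega> c C"
    and p: "1 \<le> p" and \<alpha>: "0 < \<alpha>" "\<alpha> \<le> 1"
    and dom: "open \<Omega>" "connected \<Omega>" "bounded \<Omega>" "\<Omega> \<noteq> {}"
    and john: "local_John b0 R \<Omega>"
  shows "\<exists>K. K \<le> max (2 * (1 + \<alpha> * p / CARD('n))) ((diameter \<Omega> * b0 / R) powr \<alpha>)
               * (CARD('n) / (\<alpha> * p)) powr (\<alpha> * p / (CARD('n) + \<alpha> * p))
               * (C * b0 / c) powr (\<alpha> * CARD('n) / (CARD('n) + \<alpha> * p)) \<and>
         (\<forall>v\<in>Sigma_sol A \<alpha> \<Omega>.
            Sup (v ` frontier \<Omega>) - Inf (v ` frontier \<Omega>)
              \<le> K * holder_semi \<alpha> \<Omega> v powr (CARD('n) / (CARD('n) + \<alpha> * p))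
                  * lp_norm_normalized p \<Omega> (\<lambda>x. v x - mean_on \<Omega> v) powr (\<alpha> * p / (CARD('n) + \<alpha> * p)))"
proof (intro exI conjI ballI)
  fix v assume "v \<in> Sigma_sol A \<alpha> \<Omega>"
  \<comment> \<open>This goal fixes the witness: \<open>K\<close> is the explicit constant itself,
    so its upper bound is reflexivity. The free number \<open>m\<close> is taken to be the mean of
    \<open>v\<close>.\<close>
  then show "Sup (v ` frontier \<Omega>) - Inf (v ` frontier \<Omega>)
     \<le> max (2 * (1 + \<alpha> * p / CARD('n))) ((diameter \<Omega> * b0 / R) powr \<alpha>)
      * (CARD('n) / (\<alpha> * p)) powr (\<alpha> * p / (CARD('n) + \<alpha> * p))
      * (C * b0 / c) powr (\<alpha> * CARD('n) / (CARD('n) + \<alpha> * p))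
      * holder_semi \<alpha> \<Omega> v powr (CARD('n) / (CARD('n) + \<alpha> * p))
      * lp_norm_normalized p \<Omega> (\<lambda>x. v x - mean_on \<Omega> v) powr (\<alpha> * p / (CARD('n) + \<alpha> * p))"
    by (rule solution_boundary_oscillation[OF mvp p \<alpha>(1) dom(1,3,4) john])
qed (rule order_refl)

end
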